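(* Let $n>2$ be an integer and let $A=(a_{i,j})_{1\le i,j\le n}$ be an $n\times n$ matrix with entries in a field. Then for all integers $k,l$ with $1\le k<l\le n$, $$\det\left[(a_{i,j})_{1\le i,j\le n}\right]\,\det\left[(a_{i,j})_{i\ne k,l;\; j\ne k,l}\right]=\det\left[(a_{i,j})_{i\ne l;\; j\ne l}\right]\det\left[(a_{i,j})_{i\ne k;\; j\ne k}\right]-\det\left[(a_{i,j})_{i\ne l;\; j\ne k}\right]\det\left[(a_{i,j})_{i\ne k;\; j\ne l}\right].$$
   Context: For an $n\times n$ matrix $A=(a_{i,j})_{1\le i,j\le n}$, the notation $(a_{i,j})_{i\ne i_1,\dots,i_p;\; j\ne j_1,\dots,j_q}$ denotes the $(n-p)\times(n-q)$ matrix obtained from $A$ by removing the rows with (distinct) indices $i_1,\dots,i_p$ and the columns with (distinct) indices $j_1,\dots,j_q$, keeping the remaining rows and columns in their original order. *)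

theory Defs
  imports
    Jordan_Normal_Form.Determinant
    Jordan_Normal_Form.DL_Submatrix
begin

text \<open>
  The matrix \<open>A\<close> with the rows in \<open>I\<close> and the columns in \<open>J\<close> removed is
  \<open>submatrix A (- I) (- J)\<close>: \<open>submatrix\<close> takes the index sets that are kept, discards members of
  these sets that exceed the dimensions, and enumerates the remaining ones in increasing order.
  Rows and columns are numbered from \<open>0\<close> to \<open>n - 1\<close>.
\<close>

end

theory Submission
  imports Defs
begin

text \<open>
  This is the Desnanot--Jacobi (Dodgson condensation) identity; the proof is free of division and
  works over every commutative ring. Write \<open>a\<^sub>j\<close> for the columns and \<open>C\<^sub>i\<^sub>j\<close> for the cofactors of
  \<open>A\<close>, let \<open>D\<close> be \<open>A\<close> with column \<open>k\<close> replaced by the unit vector \<open>e\<^sub>k\<close>, and let \<open>F x\<close> be the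
  determinant of \<open>D\<close> with column \<open>l\<close> replaced by \<open>x\<close>. The functional \<open>F\<close> is linear
  (\<open>det_replace_col\<close>), and orthogonality of rows and cofactors gives
  \<open>det A e\<^sub>l = (\<Sum>j. C\<^sub>l\<^sub>j a\<^sub>j)\<close>. Applying \<open>F\<close> yields \<open>det A (F e\<^sub>l) = (\<Sum>j. C\<^sub>l\<^sub>j F a\<^sub>j)\<close>.
  On the left, \<open>F e\<^sub>l\<close> is the minor without rows and columns \<open>k, l\<close>. On the right, only two summands
  survive: \<open>F a\<^sub>j = 0\<close> for \<open>j \<noteq> k, l\<close> because column \<open>j\<close> is then repeated, \<open>F a\<^sub>l = det D = C\<^sub>k\<^sub>k\<close>,
  and \<open>F a\<^sub>k = - C\<^sub>k\<^sub>l\<close> by interchanging columns \<open>k\<close> and \<open>l\<close>. Hence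
  \<open>det A (F e\<^sub>l) = C\<^sub>l\<^sub>l C\<^sub>k\<^sub>k - C\<^sub>l\<^sub>k C\<^sub>k\<^sub>l\<close>, in which the signs of the cofactors cancel. What remains
  is to identify submatrices that omit one or two indices with (iterated) uses of \<open>mat_delete\<close>.
\<close>

text \<open>
  A strictly increasing enumeration of an infinite set agrees with \<open>pick\<close>. The complements of
  \<open>{k}\<close> and \<open>{k, l}\<close> are enumerated by \<open>insert_index\<close>, the index shift used by \<open>mat_delete\<close>.
\<close>
lemma pick_range_strict_mono:
  fixes f :: "nat \<Rightarrow> nat"
  assumes "strict_mono f"
  shows "pick (range f) i = f i"
proof -
  have "{a \<in> range f. a < f i} = f ` {..<i}"
    using strict_mono_less[OF assms] by auto
  then have "card {a \<in> range f. a < f i} = i"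
    using card_image[OF inj_on_subset[OF strict_mono_imp_inj_on[OF assms] subset_UNIV]] by simp
  then show ?thesis
    using pick_card_in_set[of "f i" "range f"] by simp
qed

lemma strict_mono_insert_index: "strict_mono (insert_index k)"
  unfolding strict_mono_def insert_index_def by auto

lemma range_insert_index: "range (insert_index k) = - {k}"
proof
  show "range (insert_index k) \<subseteq> - {k}"
    by (auto simp: insert_index_def)
  show "- {k} \<subseteq> range (insert_index k)"
    by (metis ComplD insertI1 insert_delete_index rangeI subsetI)
qed

lemma pick_Compl_singleton: "pick (- {k}) i = insert_index k i"
  using pick_range_strict_mono[OF strict_mono_insert_index] by (simp add: range_insert_index)

lemma pick_Compl_pair:
  assumes "k < l"
  shows "pick (- {k, l}) i = insert_index l (insert_index k i)"
proof -
  let ?f = "insert_index l \<circ> insert_index k"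
  have inj: "inj (insert_index l)"
    by (rule strict_mono_imp_inj_on[OF strict_mono_insert_index])
  have "range ?f = insert_index l ` (- {k})"
    by (simp only: image_comp[symmetric] range_insert_index)
  also have "\<dots> = range (insert_index l) - {insert_index l k}"
    using inj by (simp add: image_set_diff Compl_eq_Diff_UNIV)
  also have "\<dots> = - {k, l}"
    using assms by (auto simp: range_insert_index)
  finally have "range ?f = - {k, l}" .
  moreover have "strict_mono ?f"
    using strict_mono_insert_index by (simp add: strict_mono_def)
  ultimately show ?thesis
    using pick_range_strict_mono[of ?f i] by simp
qed

lemma submatrix_Compl_singleton:
  assumes "A \<in> carrier_mat n n" "k < n" "l < n"
  shows "submatrix A (- {k}) (- {l}) = mat_delete A k l"
proof -
  have "card {i. i < n \<and> i \<in> - {m}} = n - 1" if "m < n" for m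
  proof -
    have "{i. i < n \<and> i \<in> - {m}} = {..<n} - {m}" by auto
    with that show ?thesis by simp
  qed
  with assms show ?thesis
    by (auto simp: submatrix_def mat_delete_def pick_Compl_singleton insert_index_def)
qed

text \<open>
  The larger index is removed first, so that the smaller one keeps its position.
\<close>
lemma submatrix_Compl_pair:
  assumes "A \<in> carrier_mat n n" "k < l" "l < n"
  shows "submatrix A (- {k, l}) (- {k, l}) = mat_delete (mat_delete A l l) k k"
proof -
  have "{i. i < n \<and> i \<in> - {k, l}} = {..<n} - {k, l}" by auto
  then have "card {i. i < n \<and> i \<in> - {k, l}} = n - 1 - 1"
    using assms by (simp add: card_Diff_subset)
  with assms show ?thesis
    by (auto simp: submatrix_def mat_delete_def pick_Compl_pair insert_index_def)
qed

lemma replace_col_carrier: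
  assumes "A \<in> carrier_mat n n"
  shows "replace_col A x k \<in> carrier_mat n n"
  using assms by (simp add: replace_col_def)

lemma det_replace_col:
  fixes A :: "'a :: comm_ring_1 mat"
  assumes A: "A \<in> carrier_mat n n" and k: "k < n"
  shows "det (replace_col A x k) = (\<Sum>i<n. x $ i * cofactor A i k)"
proof -
  have "mat_delete (replace_col A x k) i k = mat_delete A i k" if "i < n" for i
    using A k that by (auto simp: mat_delete_def replace_col_def)
  then have "cofactor (replace_col A x k) i k = cofactor A i k" if "i < n" for i
    using that by (simp add: cofactor_def)
  then show ?thesis
    using A k laplace_expansion_column[OF replace_col_carrier[OF A] k, of x]
    by (simp add: replace_col_def)
qed

lemma det_replace_col_unit:
  fixes A :: "'a :: comm_ring_1 mat"
  assumes "A \<in> carrier_mat n n" "i < n" "k < n"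
  shows "det (replace_col A (unit_vec n i) k) = cofactor A i k"
proof -
  have "det (replace_col A (unit_vec n i) k) =
      (\<Sum>i'<n. if i' = i then cofactor A i' k else 0)"
    unfolding det_replace_col[OF assms(1,3)] using assms by (intro sum.cong) auto
  then show ?thesis using assms by simp
qed

lemma row_cofactor_orthogonal:
  fixes A :: "'a :: comm_ring_1 mat"
  assumes A: "A \<in> carrier_mat n n" and "i < n" "l < n"
  shows "(\<Sum>j<n. A $$ (i, j) * cofactor A l j) = (if i = l then det A else 0)"
proof -
  have "(A * adj_mat A) $$ (i, l) = (\<Sum>j<n. A $$ (i, j) * cofactor A l j)"
    using assms by (auto simp: times_mat_def scalar_prod_def adj_mat_def intro: sum.cong)
  then show ?thesis
    using assms by (auto simp: adj_mat(2)[OF A])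
qed

text \<open>
  By \<open>det_replace_col_unit\<close>, the left-hand side is the determinant of \<open>A\<close> with columns \<open>k\<close> and \<open>l\<close>
  replaced by the corresponding unit vectors. As \<open>k < l\<close>, deleting row and column \<open>l\<close> does not move
  column \<open>k\<close>.
\<close>
lemma cofactor_replace_col_unit:
  fixes A :: "'a :: comm_ring_1 mat"
  assumes A: "A \<in> carrier_mat n n" and "k < l" "l < n"
  shows "cofactor (replace_col A (unit_vec n k) k) l l = det (mat_delete (mat_delete A l l) k k)"
proof -
  have "mat_delete (replace_col A (unit_vec n k) k) l l =
      replace_col (mat_delete A l l) (unit_vec (n - 1) k) k"
    using assms by (auto simp: mat_delete_def replace_col_def unit_vec_def)
  then have "cofactor (replace_col A (unit_vec n k) k) l l = cofactor (mat_delete A l l) k k"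
    using assms det_replace_col_unit[OF mat_delete_carrier[OF A], of k k l l]
    by (simp add: cofactor_def)
  then show ?thesis
    by (simp add: cofactor_def)
qed

lemma desnanot_jacobi_cofactor:
  fixes A :: "'a :: comm_ring_1 mat"
  assumes A: "A \<in> carrier_mat n n" and kl: "k < l" and l: "l < n"
  shows "det A * det (mat_delete (mat_delete A l l) k k) =
    cofactor A l l * cofactor A k k - cofactor A l k * cofactor A k l"
proof -
  define D where "D = replace_col A (unit_vec n k) k"
  define F where "F x = det (replace_col D x l)" for x
  have k: "k < n" using kl l by simp
  have D: "D \<in> carrier_mat n n"
    unfolding D_def using A by (rule replace_col_carrier)
  have F: "F x = (\<Sum>i<n. x $ i * cofactor D i l)" for x
    unfolding F_def by (rule det_replace_col[OF D l])
  have F_l: "F (col A l) = cofactor A k k"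
  proof -
    have "replace_col D (col A l) l = D"
      using A kl l by (auto simp: D_def replace_col_def)
    then show ?thesis
      using det_replace_col_unit[OF A k k] by (simp add: F_def D_def)
  qed
  have F_k: "F (col A k) = - cofactor A k l"
  proof -
    have "replace_col D (col A k) l = swapcols k l (replace_col A (unit_vec n k) l)"
      using A kl l by (auto simp: D_def replace_col_def)
    then show ?thesis
      using det_swapcols[OF k l _ replace_col_carrier[OF A]] kl det_replace_col_unit[OF A k l]
      by (simp add: F_def)
  qed
  \<comment> \<open>Columns \<open>j\<close> and \<open>l\<close> of the matrix then coincide.\<close>
  have F_other: "F (col A j) = 0" if "j < n" "j \<noteq> k" "j \<noteq> l" for j
    unfolding F_def
  proof (rule det_identical_columns[OF replace_col_carrier[OF D] that(3) that(1) l])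
    show "col (replace_col D (col A j) l) j = col (replace_col D (col A j) l) l"
      using A l that by (auto simp: D_def replace_col_def)
  qed
  have "(\<Sum>j<n. cofactor A l j * F (col A j)) =
      (\<Sum>j<n. \<Sum>i<n. cofactor D i l * (A $$ (i, j) * cofactor A l j))"
    using A by (auto simp: F sum_distrib_left ac_simps intro!: sum.cong)
  also have "\<dots> = (\<Sum>i<n. cofactor D i l * (\<Sum>j<n. A $$ (i, j) * cofactor A l j))"
    by (subst sum.swap) (simp add: sum_distrib_left)
  also have "\<dots> = (\<Sum>i<n. if i = l then cofactor D l l * det A else 0)"
    by (intro sum.cong) (auto simp: row_cofactor_orthogonal[OF A _ l])
  also have "\<dots> = det A * det (mat_delete (mat_delete A l l) k k)"
    using l by (simp add: D_def cofactor_replace_col_unit[OF A kl l])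
  finally have "det A * det (mat_delete (mat_delete A l l) k k) =
      (\<Sum>j<n. cofactor A l j * F (col A j))" by simp
  also have "\<dots> = (\<Sum>j\<in>{k, l}. cofactor A l j * F (col A j))"
    using k l F_other by (intro sum.mono_neutral_right) auto
  also have "\<dots> = cofactor A l l * cofactor A k k - cofactor A l k * cofactor A k l"
    using kl by (simp add: F_k F_l)
  finally show ?thesis .
qed

theorem theorem1:
  fixes A :: "'a :: field mat" and n k l :: nat
  assumes "n > 2"
    and "A \<in> carrier_mat n n"
    and "k < l" and "l < n"
  shows "det A * det (submatrix A (- {k, l}) (- {k, l})) =
    det (submatrix A (- {l}) (- {l})) * det (submatrix A (- {k}) (- {k}))
    - det (submatrix A (- {l}) (- {k})) * det (submatrix A (- {k}) (- {l}))"
proof -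
  have k: "k < n" using assms by simp
  have sign: "(- 1 :: 'a) ^ (l + k) * (- 1) ^ (k + l) = 1"
    by (simp add: add.commute[of l k] power_add[symmetric])
  have "cofactor A l k * cofactor A k l =
      ((- 1) ^ (l + k) * (- 1) ^ (k + l)) * (det (mat_delete A l k) * det (mat_delete A k l))"
    unfolding cofactor_def by (simp only: ac_simps)
  also have "\<dots> = det (mat_delete A l k) * det (mat_delete A k l)"
    unfolding sign by simp
  finally have "cofactor A l k * cofactor A k l = det (mat_delete A l k) * det (mat_delete A k l)" .
  then have "det A * det (mat_delete (mat_delete A l l) k k) =
      det (mat_delete A l l) * det (mat_delete A k k)
      - det (mat_delete A l k) * det (mat_delete A k l)"
    using desnanot_jacobi_cofactor[OF assms(2-4)] by (simp add: cofactor_def)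
  then show ?thesis
    using assms k by (simp add: submatrix_Compl_pair submatrix_Compl_singleton)
qed

end
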